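(* Let $\mathbf{N}_0\subseteq\mathbf{M}_0$ and $\mathbf{N}\subseteq\mathbf{M}$ be models of ZFC and let $\mathbf{R}=\langle X,Y,\sqsubset\rangle$ and $\mathbf{R}'=\langle X',Y',\sqsubset'\rangle$ be two real definable relational systems. If $\mathbf{R}\preceq_{\mathbf{N}_0,\mathbf{N}}^{\mathbf{M}_0,\mathbf{M}}\mathbf{R}'$, then $$\mathfrak{d}(\mathbf{R}')_{\mathbf{N}}^{\mathbf{M}}\Rightarrow\mathfrak{d}(\mathbf{R})_{\mathbf{N}_0}^{\mathbf{M}_0}\quad\text{and}\quad \mathfrak{b}(\mathbf{R})_{\mathbf{N}_0}^{\mathbf{M}_0}\Rightarrow\mathfrak{b}(\mathbf{R}')_{\mathbf{N}}^{\mathbf{M}}.$$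
   Context: Models are transitive models of ZFC (or of a large enough finite fragment of it). A relational system is a triple $\mathbf{R}=\langle X,Y,\sqsubset\rangle$ with $\sqsubset\,\subseteq X\times Y$. It is real definable if $X$ and $Y$ are non-empty and analytic in Polish spaces $Z$ and $W$, respectively, and $\sqsubset$ is analytic in $Z\times W$. For a model $\mathbf{M}$, $\mathbf{R}^{\mathbf{M}}=\langle X^{\mathbf{M}},Y^{\mathbf{M}},\sqsubset^{\mathbf{M}}\rangle$ denotes the interpretation of $\mathbf{R}$ in $\mathbf{M}$. For models $\mathbf{N}\subseteq\mathbf{M}$: - $\mathfrak{d}(\mathbf{R})_{\mathbf{N}}^{\mathbf{M}}$ is the statement: $\forall x\in X^{\mathbf{M}}\ \exists y\in Y^{\mathbf{N}}\ (x\sqsubset y)$. - $\mathfrak{b}(\mathbf{R})_{\mathbf{N}}^{\mathbf{M}}$ is the statement: $\neg\exists y\in Y^{\mathbf{M}}\ \forall x\in X^{\mathbf{N}}\ (x\sqsubset y)$. Tukey order with models: $\mathbf{R}\preceq_{\mathbf{N}_0,\mathbf{N}}^{\mathbf{M}_0,\mathbf{M}}\mathbf{R}'$ means that there are maps $\Psi_-:X^{\mathbf{M}_0}\to X'^{\mathbf{M}}$ and $\Psi_+:Y'^{\mathbf{M}}\to Y^{\mathbf{M}_0}$ such that (a) for all $x\in X^{\mathbf{M}_0}$ and all $y'\in Y'^{\mathbf{M}}$, $\Psi_-(x)\sqsubset' y'$ implies $x\sqsubset\Psi_+(y')$; and (b) $\Psi_-[X^{\mathbf{N}_0}]\subseteq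 X'^{\mathbf{N}}$ and $\Psi_+[Y'^{\mathbf{N}}]\subseteq Y^{\mathbf{N}_0}$. *)

theory Defs
  imports "HOL-Analysis.Analysis"
begin

section \<open>Transitive models of ZFC\<close>

text \<open>
  Models live in an ambient well-founded extensional structure \<open>(UNIV :: 'v set, E)\<close>. By the
  Mostowski collapse such a structure is, up to a unique isomorphism, a transitive class with the
  true membership relation, so transitive subsets of \<open>'v\<close> (possibly all of \<open>'v\<close>) are exactly the
  transitive classes lying in it. No further closure of the ambient structure is needed.
\<close>

definition set_universe :: "('v \<Rightarrow> 'v \<Rightarrow> bool) \<Rightarrow> bool" where
  "set_universe E \<longleftrightarrow> wfP E \<and> (\<forall>x y. (\<forall>z. E z x \<longleftrightarrow> E z y) \<longrightarrow> x = y)"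

definition transitive_in :: "('v \<Rightarrow> 'v \<Rightarrow> bool) \<Rightarrow> 'v set \<Rightarrow> bool" where
  "transitive_in E M \<longleftrightarrow> (\<forall>x\<in>M. \<forall>y. E y x \<longrightarrow> y \<in> M)"

text \<open>First-order formulas of set theory with named variables, for the two axiom schemas.\<close>

datatype fm = FMem nat nat | FEq nat nat | FNeg fm | FConj fm fm | FAll nat fm

primrec sat :: "('v \<Rightarrow> 'v \<Rightarrow> bool) \<Rightarrow> 'v set \<Rightarrow> (nat \<Rightarrow> 'v) \<Rightarrow> fm \<Rightarrow> bool" where
  "sat E M s (FMem i j) \<longleftrightarrow> E (s i) (s j)"
| "sat E M s (FEq i j) \<longleftrightarrow> s i = s j"
| "sat E M s (FNeg \<phi>) \<longleftrightarrow> \<not> sat E M s \<phi>"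
| "sat E M s (FConj \<phi> \<psi>) \<longleftrightarrow> sat E M s \<phi> \<and> sat E M s \<psi>"
| "sat E M s (FAll i \<phi>) \<longleftrightarrow> (\<forall>a\<in>M. sat E M (s(i := a)) \<phi>)"

text \<open>
  The axioms of ZFC relativised to \<open>M\<close>. In the schemas the assignment \<open>s\<close> supplies the parameters;
  \<open>v\<^sub>0\<close>, \<open>v\<^sub>1\<close> are the distinguished variables.
\<close>

definition ZFC_model :: "('v \<Rightarrow> 'v \<Rightarrow> bool) \<Rightarrow> 'v set \<Rightarrow> bool" where
  "ZFC_model E M \<longleftrightarrow>
    \<comment> \<open>extensionality\<close>
    (\<forall>a\<in>M. \<forall>b\<in>M. (\<forall>x\<in>M. E x a \<longleftrightarrow> E x b) \<longrightarrow> a = b) \<and>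
    \<comment> \<open>foundation\<close>
    (\<forall>a\<in>M. (\<exists>x\<in>M. E x a) \<longrightarrow> (\<exists>x\<in>M. E x a \<and> \<not> (\<exists>z\<in>M. E z x \<and> E z a))) \<and>
    \<comment> \<open>pairing\<close>
    (\<forall>a\<in>M. \<forall>b\<in>M. \<exists>c\<in>M. \<forall>x\<in>M. E x c \<longleftrightarrow> x = a \<or> x = b) \<and>
    \<comment> \<open>union\<close>
    (\<forall>a\<in>M. \<exists>u\<in>M. \<forall>x\<in>M. E x u \<longleftrightarrow> (\<exists>y\<in>M. E y a \<and> E x y)) \<and>
    \<comment> \<open>power set\<close>
    (\<forall>a\<in>M. \<exists>p\<in>M. \<forall>x\<in>M. E x p \<longleftrightarrow> (\<forall>z\<in>M. E z x \<longrightarrow> E z a)) \<and>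
    \<comment> \<open>infinity\<close>
    (\<exists>a\<in>M. (\<exists>e\<in>M. E e a \<and> (\<forall>x\<in>M. \<not> E x e)) \<and>
       (\<forall>x\<in>M. E x a \<longrightarrow> (\<exists>y\<in>M. E y a \<and> (\<forall>z\<in>M. E z y \<longleftrightarrow> E z x \<or> z = x)))) \<and>
    \<comment> \<open>separation\<close>
    (\<forall>\<phi> s. range s \<subseteq> M \<longrightarrow>
       (\<forall>a\<in>M. \<exists>b\<in>M. \<forall>x\<in>M. E x b \<longleftrightarrow> E x a \<and> sat E M (s(0 := x)) \<phi>)) \<and>
    \<comment> \<open>replacement\<close>
    (\<forall>\<phi> s. range s \<subseteq> M \<longrightarrow>
       (\<forall>a\<in>M. (\<forall>x\<in>M. E x a \<longrightarrow> (\<exists>!y. y \<in> M \<and> sat E M (s(0 := x, 1 := y)) \<phi>)) \<longrightarrow>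
          (\<exists>b\<in>M. \<forall>y\<in>M. E y b \<longleftrightarrow> (\<exists>x\<in>M. E x a \<and> sat E M (s(0 := x, 1 := y)) \<phi>)))) \<and>
    \<comment> \<open>choice: a family of non-empty pairwise disjoint sets has a transversal\<close>
    (\<forall>a\<in>M. (\<forall>x\<in>M. E x a \<longrightarrow> (\<exists>y\<in>M. E y x)) \<and>
       (\<forall>x\<in>M. \<forall>x'\<in>M. E x a \<and> E x' a \<and> x \<noteq> x' \<longrightarrow> \<not> (\<exists>y\<in>M. E y x \<and> E y x')) \<longrightarrow>
       (\<exists>c\<in>M. \<forall>x\<in>M. E x a \<longrightarrow> (\<exists>!y. y \<in> M \<and> E y x \<and> E y c)))"

definition transitive_model :: "('v \<Rightarrow> 'v \<Rightarrow> bool) \<Rightarrow> 'v set \<Rightarrow> bool" where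
  "transitive_model E M \<longleftrightarrow> transitive_in E M \<and> ZFC_model E M"

text \<open>
  Every \<open>f :: nat \<Rightarrow> nat\<close> is represented in the universe by at most one set, its graph on the
  von Neumann numerals; \<open>reals_of E M\<close> is \<open>\<omega>\<^sup>\<omega> \<inter> M\<close>.
\<close>

primrec is_numeral :: "('v \<Rightarrow> 'v \<Rightarrow> bool) \<Rightarrow> nat \<Rightarrow> 'v \<Rightarrow> bool" where
  "is_numeral E 0 v \<longleftrightarrow> (\<forall>u. \<not> E u v)"
| "is_numeral E (Suc n) v \<longleftrightarrow> (\<exists>u. is_numeral E n u \<and> (\<forall>z. E z v \<longleftrightarrow> E z u \<or> z = u))"

definition is_upair :: "('v \<Rightarrow> 'v \<Rightarrow> bool) \<Rightarrow> 'v \<Rightarrow> 'v \<Rightarrow> 'v \<Rightarrow> bool" where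
  "is_upair E a b p \<longleftrightarrow> (\<forall>z. E z p \<longleftrightarrow> z = a \<or> z = b)"

definition is_opair :: "('v \<Rightarrow> 'v \<Rightarrow> bool) \<Rightarrow> 'v \<Rightarrow> 'v \<Rightarrow> 'v \<Rightarrow> bool" where
  "is_opair E a b p \<longleftrightarrow> (\<exists>s t. is_upair E a a s \<and> is_upair E a b t \<and> is_upair E s t p)"

definition is_graph :: "('v \<Rightarrow> 'v \<Rightarrow> bool) \<Rightarrow> (nat \<Rightarrow> nat) \<Rightarrow> 'v \<Rightarrow> bool" where
  "is_graph E f v \<longleftrightarrow>
    (\<forall>p. E p v \<longleftrightarrow> (\<exists>n a b. is_numeral E n a \<and> is_numeral E (f n) b \<and> is_opair E a b p))"

definition reals_of :: "('v \<Rightarrow> 'v \<Rightarrow> bool) \<Rightarrow> 'v set \<Rightarrow> (nat \<Rightarrow> nat) set" where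
  "reals_of E M = {f. \<exists>v\<in>M. is_graph E f v}"


section \<open>Real definable relational systems\<close>

record ('z, 'w) rel_system =
  chal :: "'z set"
  resp :: "'w set"
  sq :: "('z \<times> 'w) set"

definition analytic :: "'a::topological_space set \<Rightarrow> bool" where
  "analytic A \<longleftrightarrow> A = {} \<or> (\<exists>f :: (nat \<Rightarrow> nat) \<Rightarrow> 'a. continuous_on UNIV f \<and> A = range f)"

definition real_definable :: "('z::polish_space, 'w::polish_space) rel_system \<Rightarrow> bool" where
  "real_definable R \<longleftrightarrow> sq R \<subseteq> chal R \<times> resp R \<and>
     chal R \<noteq> {} \<and> resp R \<noteq> {} \<and>
     analytic (chal R) \<and> analytic (resp R) \<and> analytic (sq R)"


section \<open>Interpretation in a model\<close>

text \<open>
  A Polish space is presented by a dense sequence \<open>e\<close>, i.e. as the completion of the countable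
  metric space \<open>\<lambda>i j. dist (e i) (e j)\<close>. If \<open>D\<close> is the set of reals of a model, its version of the
  space is the set of limits of those Cauchy sequences of indices that belong to the model (the
  completion formed in the model, identified as usual with a subset of the real completion).
\<close>

definition points :: "(nat \<Rightarrow> nat) set \<Rightarrow> (nat \<Rightarrow> 'a::metric_space) \<Rightarrow> 'a set" where
  "points D e = {z. \<exists>f\<in>D. (\<lambda>k. e (f k)) \<longlonglongrightarrow> z}"

text \<open>
  An analytic set is coded as the projection of a closed subset of the product of the space with
  Baire space. The closed set is given by a set \<open>c\<close> of triples \<open>(i, k, \<sigma>)\<close>, each standing for the
  basic open set (ball around \<open>e i\<close> of radius \<open>1 / (k + 1)\<close>) \<open>\<times>\<close> (sequences extending \<open>\<sigma>\<close>): its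
  complement is the union of these. The predicate \<open>in_closed\<close> is absolute; only
  the quantifier over the witness \<open>w\<close> is relativised to the model. With \<open>D = UNIV\<close> one obtains
  the set itself.
\<close>

type_synonym code = "(nat \<times> nat \<times> nat list) set"

definition in_closed ::
  "(nat \<Rightarrow> 'a::metric_space) \<Rightarrow> code \<Rightarrow> 'a \<Rightarrow> (nat \<Rightarrow> nat) \<Rightarrow> bool" where
  "in_closed e c z w \<longleftrightarrow>
    (\<forall>(i, k, \<sigma>)\<in>c. \<not> (dist (e i) z < 1 / real (Suc k) \<and> map w [0..<length \<sigma>] = \<sigma>))"

definition analytic_interp ::
  "(nat \<Rightarrow> nat) set \<Rightarrow> (nat \<Rightarrow> 'a::metric_space) \<Rightarrow> code \<Rightarrow> 'a set" where
  "analytic_interp D e c = {z \<in> points D e. \<exists>w\<in>D. in_closed e c z w}"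

record ('z, 'w) system_definition =
  seqZ :: "nat \<Rightarrow> 'z"
  seqW :: "nat \<Rightarrow> 'w"
  codeX :: code
  codeY :: code
  codeR :: code

definition pair_seq :: "(nat \<Rightarrow> 'z) \<Rightarrow> (nat \<Rightarrow> 'w) \<Rightarrow> nat \<Rightarrow> 'z \<times> 'w" where
  "pair_seq e e' n = (e (fst (prod_decode n)), e' (snd (prod_decode n)))"

definition interp_reals ::
  "(nat \<Rightarrow> nat) set \<Rightarrow> ('z::metric_space, 'w::metric_space) system_definition \<Rightarrow> ('z, 'w) rel_system" where
  "interp_reals D \<rho> =
    \<lparr>chal = analytic_interp D (seqZ \<rho>) (codeX \<rho>),
     resp = analytic_interp D (seqW \<rho>) (codeY \<rho>),
     sq = analytic_interp D (pair_seq (seqZ \<rho>) (seqW \<rho>)) (codeR \<rho>)\<rparr>"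

text \<open>
  The interpretation of \<open>R\<close> in a model refers to a definition \<open>\<rho>\<close> of \<open>R\<close>. It is total in the
  model; it is what the model itself computes if the reals coding \<open>\<rho>\<close> (the metrics on the two
  dense sequences and the three codes) belong to the model.
\<close>

definition is_definition_of ::
  "('z::polish_space, 'w::polish_space) system_definition \<Rightarrow> ('z, 'w) rel_system \<Rightarrow> bool" where
  "is_definition_of \<rho> R \<longleftrightarrow> closure (range (seqZ \<rho>)) = UNIV \<and> closure (range (seqW \<rho>)) = UNIV \<and>
     interp_reals UNIV \<rho> = R"

lemma points_UNIV:
  fixes e :: "nat \<Rightarrow> 'a::metric_space"
  assumes "closure (range e) = UNIV"
  shows "points UNIV e = UNIV"
proof -
  have "\<exists>f. (\<lambda>k. e (f k)) \<longlonglongrightarrow> z" for z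
  proof -
    obtain x where x: "\<And>n. x n \<in> range e" "x \<longlonglongrightarrow> z"
      using assms closure_sequential[of z "range e"] by auto
    then have "\<exists>f. \<forall>n. x n = e (f n)" by (intro choice) blast
    then obtain f where "\<And>n. x n = e (f n)" by blast
    then show ?thesis using x(2) by (metis (no_types, lifting) ext)
  qed
  then show ?thesis by (auto simp: points_def)
qed

lemma dense_seq_near:
  fixes e :: "nat \<Rightarrow> 'a::metric_space"
  assumes "closure (range e) = UNIV" "r > 0"
  shows "\<exists>i. dist (e i) z < r"
  using assms closure_approachable[of z "range e"] by auto

lemma open_cylinder:
  fixes U :: "(nat \<Rightarrow> nat) set"
  assumes "open U" "w \<in> U"
  shows "\<exists>n. \<forall>w'. map w' [0..<n] = map w [0..<n] \<longrightarrow> w' \<in> U"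
proof -
  have "openin (product_topology (\<lambda>i. euclidean) UNIV) U"
    using assms(1) by (simp add: open_fun_def)
  from product_topology_open_contains_basis[OF this assms(2)]
  obtain X where X: "w \<in> (\<Pi>\<^sub>E i\<in>UNIV. X i)" "finite {i. X i \<noteq> UNIV}" "(\<Pi>\<^sub>E i\<in>UNIV. X i) \<subseteq> U"
    by auto
  obtain n where n: "\<And>i. X i \<noteq> UNIV \<Longrightarrow> i < n"
    using X(2) by (metis (mono_tags, lifting) finite_nat_set_iff_bounded mem_Collect_eq)
  have "w' \<in> U" if "map w' [0..<n] = map w [0..<n]" for w'
  proof -
    have "w' i \<in> X i" for i
      using X(1) n[of i] that by (cases "X i = UNIV") (auto simp: PiE_iff)
    then show ?thesis using X(3) by (auto simp: PiE_iff)
  qed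
  then show ?thesis by blast
qed

lemma analytic_has_code:
  fixes e :: "nat \<Rightarrow> 'a::metric_space"
  assumes e: "closure (range e) = UNIV" and A: "analytic A"
  shows "\<exists>c. analytic_interp UNIV e c = A"
proof (cases "A = {}")
  case True
  have "\<not> in_closed e {(i, 0, []) | i. True} z w" for z w
    using dense_seq_near[OF e, of 1 z] by (auto simp: in_closed_def)
  then show ?thesis using True by (auto simp: analytic_interp_def)
next
  case False
  then obtain f :: "(nat \<Rightarrow> nat) \<Rightarrow> 'a" where f: "continuous_on UNIV f" "A = range f"
    using A by (auto simp: analytic_def)
  define c where "c = {(i, k, \<sigma>). \<forall>z w. dist (e i) z < 1 / real (Suc k) \<and>
    map w [0..<length \<sigma>] = \<sigma> \<longrightarrow> f w \<noteq> z}"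
  have "f w = z" if cl: "in_closed e c z w" for z w
  proof (rule ccontr)
    assume ne: "f w \<noteq> z"
    define d where "d = dist (f w) z"
    have d: "d > 0" using ne by (simp add: d_def)
    have "open (f -` ball (f w) (d/2))"
      using f(1) by (simp add: continuous_on_open_vimage)
    then obtain n where n: "\<And>w'. map w' [0..<n] = map w [0..<n] \<Longrightarrow> dist (f w) (f w') < d/2"
      using open_cylinder[of "f -` ball (f w) (d/2)" w] d by auto
    obtain k where k: "1 / real (Suc k) < d/4"
      using nat_approx_posE[of "d/4"] d by auto
    obtain i where i: "dist (e i) z < 1 / real (Suc k)"
      using dense_seq_near[OF e, of "1 / real (Suc k)" z] by auto
    have "f w' \<noteq> z'" if 1: "dist (e i) z' < 1 / real (Suc k)" "map w' [0..<n] = map w [0..<n]"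
      for z' w'
    proof
      assume "f w' = z'"
      then have "dist (f w) z' < d/2" using n[OF 1(2)] by simp
      moreover have "dist z' z < d/2"
        using dist_triangle3[of z' z "e i"] 1(1) i k by linarith
      ultimately show False
        using dist_triangle[of "f w" z z'] by (simp add: d_def)
    qed
    then have "(i, k, map w [0..<n]) \<in> c" by (auto simp: c_def)
    then show False using cl i by (auto simp: in_closed_def)
  qed
  moreover have "in_closed e c (f w) w" for w
    by (auto simp: in_closed_def c_def)
  ultimately have "analytic_interp UNIV e c = A"
    by (auto simp: analytic_interp_def points_UNIV[OF e] f(2))
  then show ?thesis by blast
qed

lemma ex_dense_seq: "\<exists>e :: nat \<Rightarrow> 'a::second_countable_topology. closure (range e) = UNIV"
proof -
  obtain D :: "'a set" where D: "countable D" "\<And>X. open X \<Longrightarrow> X \<noteq> {} \<Longrightarrow> \<exists>d\<in>D. d \<in> X"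
    using countable_dense_exists[where 'a = 'a] by auto
  have "D \<noteq> {}" using D(2)[of UNIV] by auto
  then have "range (from_nat_into D) = D" using D(1) by (rule range_from_nat_into)
  moreover have "closure D = UNIV"
    using D(2) by (auto simp: closure_iff_nhds_not_empty) blast
  ultimately show ?thesis by metis
qed

lemma closure_pair_seq:
  assumes "closure (range e) = UNIV" "closure (range e') = UNIV"
  shows "closure (range (pair_seq e e')) = UNIV"
proof -
  have "range (pair_seq e e') = range e \<times> range e'"
    by (auto simp: pair_seq_def image_iff) (metis fst_conv prod_encode_inverse snd_conv)
  then show ?thesis using assms by (simp add: closure_Times)
qed

text \<open>Every real definable system has a definition.\<close>

lemma real_definable_has_definition:
  assumes "real_definable R"
  shows "\<exists>\<rho>. is_definition_of \<rho> R"
proof -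
  obtain e :: "nat \<Rightarrow> 'a" where e: "closure (range e) = UNIV" using ex_dense_seq by blast
  obtain e' :: "nat \<Rightarrow> 'b" where e': "closure (range e') = UNIV" using ex_dense_seq by blast
  obtain c1 where "analytic_interp UNIV e c1 = chal R"
    using analytic_has_code[OF e] assms unfolding real_definable_def by blast
  moreover obtain c2 where "analytic_interp UNIV e' c2 = resp R"
    using analytic_has_code[OF e'] assms unfolding real_definable_def by blast
  moreover obtain c3 where "analytic_interp UNIV (pair_seq e e') c3 = sq R"
    using analytic_has_code[OF closure_pair_seq[OF e e']] assms unfolding real_definable_def by blast
  ultimately have "is_definition_of \<lparr>seqZ = e, seqW = e', codeX = c1, codeY = c2, codeR = c3\<rparr> R"
    using e e' by (simp add: is_definition_of_def interp_reals_def)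
  then show ?thesis by blast
qed

definition interp ::
  "('v \<Rightarrow> 'v \<Rightarrow> bool) \<Rightarrow> 'v set \<Rightarrow> ('z::metric_space, 'w::metric_space) system_definition
    \<Rightarrow> ('z, 'w) rel_system" where
  "interp E M \<rho> = interp_reals (reals_of E M) \<rho>"


section \<open>The statements \<open>\<dd>\<close> and \<open>\<bb>\<close> and the Tukey order with models\<close>

text \<open>In each case \<open>\<rho>\<close> is a definition of \<open>R\<close>, and \<open>\<rho>'\<close> of \<open>R'\<close>.\<close>

definition dd_stmt ::
  "('v \<Rightarrow> 'v \<Rightarrow> bool) \<Rightarrow> 'v set \<Rightarrow> 'v set \<Rightarrow> ('z::polish_space, 'w::polish_space) rel_system
    \<Rightarrow> ('z, 'w) system_definition \<Rightarrow> bool" where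
  "dd_stmt E N M R \<rho> \<longleftrightarrow>
    (\<forall>x\<in>chal (interp E M \<rho>). \<exists>y\<in>resp (interp E N \<rho>). (x, y) \<in> sq R)"

definition bb_stmt ::
  "('v \<Rightarrow> 'v \<Rightarrow> bool) \<Rightarrow> 'v set \<Rightarrow> 'v set \<Rightarrow> ('z::polish_space, 'w::polish_space) rel_system
    \<Rightarrow> ('z, 'w) system_definition \<Rightarrow> bool" where
  "bb_stmt E N M R \<rho> \<longleftrightarrow>
    \<not> (\<exists>y\<in>resp (interp E M \<rho>). \<forall>x\<in>chal (interp E N \<rho>). (x, y) \<in> sq R)"

definition tukey_models ::
  "('v \<Rightarrow> 'v \<Rightarrow> bool) \<Rightarrow> 'v set \<Rightarrow> 'v set \<Rightarrow> 'v set \<Rightarrow> 'v set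
    \<Rightarrow> ('z::polish_space, 'w::polish_space) rel_system \<Rightarrow> ('z, 'w) system_definition
    \<Rightarrow> ('z2::polish_space, 'w2::polish_space) rel_system \<Rightarrow> ('z2, 'w2) system_definition \<Rightarrow> bool" where
  "tukey_models E N\<^sub>0 M\<^sub>0 N M R \<rho> R' \<rho>' \<longleftrightarrow>
    (\<exists>\<Psi>\<^sub>m \<Psi>\<^sub>p.
       \<Psi>\<^sub>m \<in> chal (interp E M\<^sub>0 \<rho>) \<rightarrow> chal (interp E M \<rho>') \<and>
       \<Psi>\<^sub>p \<in> resp (interp E M \<rho>') \<rightarrow> resp (interp E M\<^sub>0 \<rho>) \<and>
       (\<forall>x\<in>chal (interp E M\<^sub>0 \<rho>). \<forall>y'\<in>resp (interp E M \<rho>').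
          (\<Psi>\<^sub>m x, y') \<in> sq R' \<longrightarrow> (x, \<Psi>\<^sub>p y') \<in> sq R) \<and>
       \<Psi>\<^sub>m ` chal (interp E N\<^sub>0 \<rho>) \<subseteq> chal (interp E N \<rho>') \<and>
       \<Psi>\<^sub>p ` resp (interp E N \<rho>') \<subseteq> resp (interp E N\<^sub>0 \<rho>))"

end

theory Submission
  imports Defs
begin

text \<open>
  A Tukey connection turns a dominating family for \<open>R'\<close> into one for \<open>R\<close> along \<open>\<Psi>\<^sub>p\<close>, and an
  unbounded family for \<open>R\<close> into one for \<open>R'\<close> along \<open>\<Psi>\<^sub>m\<close>; here the families are the responses and
  challenges that lie in the smaller models. Given a challenge \<open>x\<close> in \<open>M\<^sub>0\<close>, a response \<open>y'\<close> in \<open>N\<close>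
  that meets \<open>\<Psi>\<^sub>m x\<close> yields the response \<open>\<Psi>\<^sub>p y'\<close> in \<open>N\<^sub>0\<close> that meets \<open>x\<close>. Dually, if some \<open>y'\<close> in
  \<open>M\<close> meets all challenges of \<open>R'\<close> in \<open>N\<close>, then \<open>\<Psi>\<^sub>p y'\<close> meets all challenges of \<open>R\<close> in \<open>N\<^sub>0\<close>.

  The Tukey implication is available only between points of the larger models \<open>M\<^sub>0\<close> and \<open>M\<close>, so one
  has to know that \<open>y'\<close>, in the first argument, and the challenges in \<open>N\<^sub>0\<close>, in the second, also
  belong to the interpretations there. This is the upward absoluteness of analytic sets.
\<close>

text \<open>
  Upward absoluteness: both the Cauchy sequence naming a point and the witness for the projection
  are sought among the reals of the model, while the closed condition on them is absolute. A larger
  supply of reals can therefore only add points.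
\<close>

lemma analytic_interp_mono:
  assumes "D \<subseteq> D'"
  shows "analytic_interp D e c \<subseteq> analytic_interp D' e c"
  using assms by (auto simp: analytic_interp_def points_def)

lemma reals_of_mono: "N \<subseteq> M \<Longrightarrow> reals_of E N \<subseteq> reals_of E M"
  by (auto simp: reals_of_def)

lemma interp_mono:
  assumes "N \<subseteq> M"
  shows chal_interp_mono: "chal (interp E N \<rho>) \<subseteq> chal (interp E M \<rho>)"
    and resp_interp_mono: "resp (interp E N \<rho>) \<subseteq> resp (interp E M \<rho>)"
  using analytic_interp_mono[OF reals_of_mono[OF assms]]
  by (simp_all add: interp_def interp_reals_def)

theorem lemma1p3:
  fixes E :: "'v \<Rightarrow> 'v \<Rightarrow> bool"
    and N\<^sub>0 M\<^sub>0 N M :: "'v set"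
    and R :: "('z::polish_space, 'w::polish_space) rel_system"
    and \<rho> :: "('z, 'w) system_definition"
    and R' :: "('z2::polish_space, 'w2::polish_space) rel_system"
    and \<rho>' :: "('z2, 'w2) system_definition"
  assumes "set_universe E"
    and "transitive_model E N\<^sub>0" and "transitive_model E M\<^sub>0" and "N\<^sub>0 \<subseteq> M\<^sub>0"
    and "transitive_model E N" and "transitive_model E M" and "N \<subseteq> M"
    and "real_definable R" and "is_definition_of \<rho> R"
    and "real_definable R'" and "is_definition_of \<rho>' R'"
    and "tukey_models E N\<^sub>0 M\<^sub>0 N M R \<rho> R' \<rho>'"
  shows "(dd_stmt E N M R' \<rho>' \<longrightarrow> dd_stmt E N\<^sub>0 M\<^sub>0 R \<rho>) \<and>
         (bb_stmt E N\<^sub>0 M\<^sub>0 R \<rho> \<longrightarrow> bb_stmt E N M R' \<rho>')"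
proof -
  obtain \<Psi>\<^sub>m \<Psi>\<^sub>p where
    m: "\<And>x. x \<in> chal (interp E M\<^sub>0 \<rho>) \<Longrightarrow> \<Psi>\<^sub>m x \<in> chal (interp E M \<rho>')" and
    p: "\<And>y'. y' \<in> resp (interp E M \<rho>') \<Longrightarrow> \<Psi>\<^sub>p y' \<in> resp (interp E M\<^sub>0 \<rho>)" and
    connection: "\<And>x y'. x \<in> chal (interp E M\<^sub>0 \<rho>) \<Longrightarrow> y' \<in> resp (interp E M \<rho>') \<Longrightarrow>
      (\<Psi>\<^sub>m x, y') \<in> sq R' \<Longrightarrow> (x, \<Psi>\<^sub>p y') \<in> sq R" and
    m_small: "\<And>x. x \<in> chal (interp E N\<^sub>0 \<rho>) \<Longrightarrow> \<Psi>\<^sub>m x \<in> chal (interp E N \<rho>')" and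
    p_small: "\<And>y'. y' \<in> resp (interp E N \<rho>') \<Longrightarrow> \<Psi>\<^sub>p y' \<in> resp (interp E N\<^sub>0 \<rho>)"
    using \<open>tukey_models E N\<^sub>0 M\<^sub>0 N M R \<rho> R' \<rho>'\<close>
    unfolding tukey_models_def Pi_iff image_subset_iff by blast
  have "dd_stmt E N\<^sub>0 M\<^sub>0 R \<rho>" if dd: "dd_stmt E N M R' \<rho>'"
    unfolding dd_stmt_def
  proof
    fix x assume x: "x \<in> chal (interp E M\<^sub>0 \<rho>)"
    obtain y' where y': "y' \<in> resp (interp E N \<rho>')" "(\<Psi>\<^sub>m x, y') \<in> sq R'"
      using dd m[OF x] unfolding dd_stmt_def by blast
    have "y' \<in> resp (interp E M \<rho>')"
      using y'(1) resp_interp_mono[OF \<open>N \<subseteq> M\<close>] by blast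
    then have "(x, \<Psi>\<^sub>p y') \<in> sq R"
      using connection x y'(2) by blast
    then show "\<exists>y\<in>resp (interp E N\<^sub>0 \<rho>). (x, y) \<in> sq R"
      using p_small[OF y'(1)] by blast
  qed
  moreover have "bb_stmt E N M R' \<rho>'" if bb: "bb_stmt E N\<^sub>0 M\<^sub>0 R \<rho>"
    unfolding bb_stmt_def
  proof
    assume "\<exists>y'\<in>resp (interp E M \<rho>'). \<forall>x'\<in>chal (interp E N \<rho>'). (x', y') \<in> sq R'"
    then obtain y' where y': "y' \<in> resp (interp E M \<rho>')"
      and bound: "\<And>x'. x' \<in> chal (interp E N \<rho>') \<Longrightarrow> (x', y') \<in> sq R'"
      by blast
    have "(x, \<Psi>\<^sub>p y') \<in> sq R" if x: "x \<in> chal (interp E N\<^sub>0 \<rho>)" for x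
    proof (rule connection)
      show "x \<in> chal (interp E M\<^sub>0 \<rho>)"
        using x chal_interp_mono[OF \<open>N\<^sub>0 \<subseteq> M\<^sub>0\<close>] by blast
      show "(\<Psi>\<^sub>m x, y') \<in> sq R'"
        using bound m_small[OF x] .
    qed (rule y')
    then show False
      using bb p[OF y'] unfolding bb_stmt_def by blast
  qed
  ultimately show ?thesis by blast
qed

end
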